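(* Let $\alpha\in(1,2)$ and let $(Y_i)_{i\ge1}$ be independent, identically distributed real random variables in the normal domain of attraction of an $\alpha$-stable distribution. Then for all $0<p<\alpha$, $$\sup_{n\ge1}\mathbb{E}\left[\left|\frac{Y_1+\cdots+Y_n}{n^{1/\alpha}}\right|^p\right]<+\infty.$$
   Context: A real random variable $Y$ is in the normal domain of attraction of an $\alpha$-stable distribution if there exist $A>0$ and a function $\varepsilon$ with $|\varepsilon(x)|\le K_\varepsilon|x|^{-\gamma}$ for $|x|\ge1$ (for some constants $K_\varepsilon,\gamma>0$) such that its cumulative distribution function $F_Y$ satisfies, for all $t\ge1$, $$1-F_Y(t)=\frac{A+\varepsilon(t)}{t^\alpha}\qquad\text{and}\qquad F_Y(-t)=\frac{A+\varepsilon(-t)}{t^\alpha}.$$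
   Formalization: The formal theorem additionally assumes that the Y_i are centered, E[Y_1]=0; without this the claim is false (e.g. a symmetric Pareto variable shifted by 1), and it fails whenever the mean is nonzero. *)

theory Defs
  imports "HOL-Probability.Probability"
begin

definition normal_domain_of_attraction :: "real \<Rightarrow> 'a measure \<Rightarrow> ('a \<Rightarrow> real) \<Rightarrow> bool" where
  "normal_domain_of_attraction \<alpha> M Y \<longleftrightarrow>
     Y \<in> borel_measurable M \<and>
     (\<exists>A>0. \<exists>\<epsilon> :: real \<Rightarrow> real.
        (\<exists>K>0. \<exists>\<gamma>>0. \<forall>x. \<bar>x\<bar> \<ge> 1 \<longrightarrow> \<bar>\<epsilon> x\<bar> \<le> K * \<bar>x\<bar> powr (- \<gamma>)) \<and>
        (\<forall>t\<ge>1. 1 - cdf (distr M borel Y) t = (A + \<epsilon> t) / t powr \<alpha> \<and>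
               cdf (distr M borel Y) (- t) = (A + \<epsilon> (- t)) / t powr \<alpha>))"

end

(* The sum is shown to be uniformly of weak type alpha: P(|S_n| > t n^(1/alpha)) <= D t^(-alpha)
   for all n >= 1 and t >= 1.  Truncate every Y_i at the level T = t n^(1/alpha), which depends
   on t as well as on n.  Some Y_i exceeds T with probability at most C n T^(-alpha) = C t^(-alpha).
   Otherwise S_n is the sum of the truncated variables, to which Chebyshev's inequality applies:
   the truncated second moment is O(T^(2-alpha)) and, because the Y_i are centered, the truncated
   mean is O(T^(1-alpha)).  A weak-type bound of order alpha controls all moments of order
   p < alpha.  Moments are estimated from tails by dyadic decomposition. *)

theory Submission
  imports Defs
begin

section \<open>Dyadic brackets\<close>

lemma dyadic_bracket_above:
  fixes x :: real
  assumes "1 < x"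
  obtains k :: nat where "2 ^ k < x" "x \<le> 2 ^ Suc k"
proof -
  obtain n where "x \<le> 2 ^ n"
    using real_arch_pow[of 2 x] by (auto intro: less_imp_le)
  \<comment> \<open>The least exponent n with x \<le> 2^n is not 0 because x > 2^0, so it is a
    successor \<open>Suc k\<close>, and minimality gives 2^k < x.\<close>
  then show thesis
    using ex_least_nat_less[of "\<lambda>n. x \<le> 2 ^ n" n] assms that by (auto simp: not_le)
qed

text \<open>The strict end is switched because this version is applied to T / X: its strict upper
  bound becomes a strict lower bound on X, as the tail events require.\<close>

lemma dyadic_bracket_below:
  fixes x :: real
  assumes "1 \<le> x"
  obtains k :: nat where "2 ^ k \<le> x" "x < 2 ^ Suc k"
proof -
  obtain n where "x < 2 ^ n"
    using real_arch_pow[of 2 x] by auto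
  then show thesis
    using ex_least_nat_less[of "\<lambda>n. x < 2 ^ n" n] assms that by (auto simp: not_less)
qed

lemma two_power_powr: "(2 ^ k :: real) powr a = (2 powr a) ^ k"
  by (simp add: powr_realpow[symmetric] powr_powr mult.commute)

section \<open>Moments from tail probabilities\<close>

context prob_space
begin

text \<open>Integrating termwise turns each layer into weight times tail probability, which leaves a
  geometric series of ratio \<open>r * q\<close>. The thresholds \<open>s k\<close> are left free so
  that both increasing and decreasing dyadic levels fit.\<close>

lemma nn_integral_le_geometric:
  fixes X :: "'a \<Rightarrow> real"
  assumes [measurable]: "X \<in> borel_measurable M"
    and le: "\<And>\<omega>. \<omega> \<in> space M \<Longrightarrow>
      f \<omega> \<le> (\<Sum>k. ennreal (c * r ^ k) * indicator {\<omega> \<in> space M. s k < X \<omega>} \<omega>)"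
    and tail: "\<And>k. prob {\<omega> \<in> space M. s k < X \<omega>} \<le> d * q ^ k"
    and nonneg: "0 \<le> c" "0 \<le> r" "0 \<le> d" "0 \<le> q" and "r * q < 1"
  shows "(\<integral>\<^sup>+\<omega>. f \<omega> \<partial>M) \<le> ennreal (c * d / (1 - r * q))"
proof -
  have sums: "(\<lambda>k. c * d * (r * q) ^ k) sums (c * d * (1 / (1 - r * q)))"
    using nonneg \<open>r * q < 1\<close> by (intro sums_mult geometric_sums) (simp add: abs_of_nonneg)
  have "(\<integral>\<^sup>+\<omega>. f \<omega> \<partial>M)
      \<le> (\<integral>\<^sup>+\<omega>. (\<Sum>k. ennreal (c * r ^ k) * indicator {\<omega> \<in> space M. s k < X \<omega>} \<omega>) \<partial>M)"
    by (intro nn_integral_mono le)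
  also have "\<dots> = (\<Sum>k. ennreal (c * r ^ k) * emeasure M {\<omega> \<in> space M. s k < X \<omega>})"
    by (subst nn_integral_suminf) (simp_all add: nn_integral_cmult_indicator)
  also have "\<dots> \<le> (\<Sum>k. ennreal (c * d * (r * q) ^ k))"
  proof (intro suminf_le summableI)
    fix k
    have "ennreal (c * r ^ k) * emeasure M {\<omega> \<in> space M. s k < X \<omega>}
        \<le> ennreal (c * r ^ k) * ennreal (d * q ^ k)"
      using tail[of k] by (intro mult_left_mono) (simp_all add: emeasure_eq_measure ennreal_leI)
    also have "\<dots> = ennreal (c * d * (r * q) ^ k)"
      using nonneg by (simp add: ennreal_mult[symmetric] power_mult_distrib mult_ac)
    finally show "ennreal (c * r ^ k) * emeasure M {\<omega> \<in> space M. s k < X \<omega>}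
        \<le> ennreal (c * d * (r * q) ^ k)" .
  qed
  also have "\<dots> = ennreal (c * d / (1 - r * q))"
  proof -
    have "(\<lambda>k. ennreal (c * d * (r * q) ^ k)) sums ennreal (c * d * (1 / (1 - r * q)))"
      using nonneg sums \<open>r * q < 1\<close> by (subst sums_ennreal) auto
    then show ?thesis
      by (simp add: sums_iff)
  qed
  finally show ?thesis .
qed

lemma single_le_suminf_ennreal: "(f k :: ennreal) \<le> (\<Sum>k. f k)"
  using sum_le_suminf[OF summableI, of "{k}" f] by simp

text \<open>On the layer T 2^k < X \<le> T 2^(k+1) the power is at most (2T)^p 2^(pk), while the
  layer has probability at most C T^(-a) 2^(-ak). The ratio 2^(p-a) is below 1 because p < a. The
  case p = 1 controls the mean lost by truncation, and T = 1 gives the final moment bound.\<close>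

lemma nn_integral_powr_above_le:
  fixes X :: "'a \<Rightarrow> real"
  assumes [measurable]: "X \<in> borel_measurable M"
    and tail: "\<And>t. T \<le> t \<Longrightarrow> prob {\<omega> \<in> space M. t < X \<omega>} \<le> C * t powr (- a)"
    and "0 < T" "0 \<le> C" "0 < p" "p < a"
  shows "(\<integral>\<^sup>+\<omega>. ennreal (X \<omega> powr p) * indicator {T<..} (X \<omega>) \<partial>M)
    \<le> ennreal (C * 2 powr p / (1 - 2 powr (p - a)) * T powr (p - a))"
proof -
  have "(\<integral>\<^sup>+\<omega>. ennreal (X \<omega> powr p) * indicator {T<..} (X \<omega>) \<partial>M)
    \<le> ennreal ((2 * T) powr p * (C * T powr (- a)) / (1 - 2 powr p * 2 powr (- a)))"
  proof (rule nn_integral_le_geometric)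
    fix \<omega> assume \<omega>: "\<omega> \<in> space M"
    show "ennreal (X \<omega> powr p) * indicator {T<..} (X \<omega>)
      \<le> (\<Sum>k. ennreal ((2 * T) powr p * (2 powr p) ^ k)
            * indicator {\<omega> \<in> space M. T * 2 ^ k < X \<omega>} \<omega>)" (is "_ \<le> (\<Sum>k. ?g k)")
    proof (cases "T < X \<omega>")
      case True
      then obtain k where k: "2 ^ k < X \<omega> / T" "X \<omega> / T \<le> 2 ^ Suc k"
        using dyadic_bracket_above[of "X \<omega> / T"] \<open>0 < T\<close> by auto
      have "X \<omega> powr p \<le> (2 * T * 2 ^ k) powr p"
        using k \<open>0 < T\<close> \<open>0 < p\<close> True by (intro powr_mono2) (auto simp: field_simps)
      also have "\<dots> = (2 * T) powr p * (2 powr p) ^ k"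
        using \<open>0 < T\<close> by (simp add: powr_mult two_power_powr)
      finally have "ennreal (X \<omega> powr p) * indicator {T<..} (X \<omega>) \<le> ?g k"
        using k \<open>0 < T\<close> \<omega> True by (auto simp: field_simps intro!: ennreal_leI)
      also have "\<dots> \<le> (\<Sum>k. ?g k)"
        by (rule single_le_suminf_ennreal)
      finally show ?thesis .
    qed simp
  next
    fix k
    have "prob {\<omega> \<in> space M. T * 2 ^ k < X \<omega>} \<le> C * (T * 2 ^ k) powr (- a)"
      using \<open>0 < T\<close> by (intro tail) simp
    also have "\<dots> = C * T powr (- a) * (2 powr (- a)) ^ k"
      using \<open>0 < T\<close> by (simp add: powr_mult two_power_powr)
    finally show "prob {\<omega> \<in> space M. T * 2 ^ k < X \<omega>} \<le> C * T powr (- a) * (2 powr (- a)) ^ k" .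
  next
    have "2 powr (p - a) < 2 powr (0::real)"
      using \<open>p < a\<close> by (subst powr_less_cancel_iff) auto
    then show "2 powr p * 2 powr (- a) < (1::real)"
      by (simp add: powr_add[symmetric])
  qed (use assms in auto)
  also have "(2 * T) powr p * (C * T powr (- a)) / (1 - 2 powr p * 2 powr (- a))
    = C * 2 powr p / (1 - 2 powr (p - a)) * T powr (p - a)"
    using \<open>0 < T\<close> by (simp add: powr_mult powr_diff powr_minus field_simps)
  finally show ?thesis .
qed

text \<open>The layers T/2^(k+1) < X \<le> T/2^k now descend to 0, so the tail bound is required at
  every positive t. The power decays like 2^(-qk) and the tail bound grows like 2^(ak); a < q makes
  the series converge. The factor 2^a comes from evaluating the tail at the lower end of the
  layer.\<close>

lemma nn_integral_powr_below_le:
  fixes X :: "'a \<Rightarrow> real"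
  assumes [measurable]: "X \<in> borel_measurable M"
    and tail: "\<And>t. 0 < t \<Longrightarrow> prob {\<omega> \<in> space M. t < X \<omega>} \<le> C * t powr (- a)"
    and "0 < T" "0 \<le> C" "0 < q" "a < q"
  shows "(\<integral>\<^sup>+\<omega>. ennreal (X \<omega> powr q) * indicator {0..T} (X \<omega>) \<partial>M)
    \<le> ennreal (C * 2 powr a / (1 - 2 powr (a - q)) * T powr (q - a))"
proof -
  have "(\<integral>\<^sup>+\<omega>. ennreal (X \<omega> powr q) * indicator {0..T} (X \<omega>) \<partial>M)
    \<le> ennreal (T powr q * (C * 2 powr a * T powr (- a)) / (1 - 2 powr (- q) * 2 powr a))"
  proof (rule nn_integral_le_geometric)
    fix \<omega> assume \<omega>: "\<omega> \<in> space M"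
    show "ennreal (X \<omega> powr q) * indicator {0..T} (X \<omega>)
      \<le> (\<Sum>k. ennreal (T powr q * (2 powr (- q)) ^ k)
            * indicator {\<omega> \<in> space M. T / (2 * 2 ^ k) < X \<omega>} \<omega>)" (is "_ \<le> (\<Sum>k. ?g k)")
    proof (cases "0 < X \<omega> \<and> X \<omega> \<le> T")
      case True
      then obtain k where k: "2 ^ k \<le> T / X \<omega>" "T / X \<omega> < 2 ^ Suc k"
        using dyadic_bracket_below[of "T / X \<omega>"] \<open>0 < T\<close> by auto
      have "X \<omega> powr q \<le> (T / 2 ^ k) powr q"
        using k \<open>0 < T\<close> \<open>0 < q\<close> True by (intro powr_mono2) (auto simp: field_simps)
      also have "\<dots> = T powr q * (2 powr (- q)) ^ k"
        using \<open>0 < T\<close> by (simp add: powr_divide two_power_powr powr_minus field_simps)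
      finally have "ennreal (X \<omega> powr q) * indicator {0..T} (X \<omega>) \<le> ?g k"
        using k \<open>0 < T\<close> \<omega> True by (auto simp: field_simps intro!: ennreal_leI)
      also have "\<dots> \<le> (\<Sum>k. ?g k)"
        by (rule single_le_suminf_ennreal)
      finally show ?thesis .
    next
      \<comment> \<open>No layer contains a point with X = 0, but there \<open>0 powr q\<close> is
        0.\<close>
      case False
      then have "ennreal (X \<omega> powr q) * indicator {0..T} (X \<omega>) = 0"
        using \<open>0 < q\<close> by (cases "X \<omega> = 0") (auto simp: indicator_def)
      then show ?thesis by (simp only: zero_le)
    qed
  next
    fix k
    have "prob {\<omega> \<in> space M. T / (2 * 2 ^ k) < X \<omega>} \<le> C * (T / (2 * 2 ^ k)) powr (- a)"
      using \<open>0 < T\<close> by (intro tail) simp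
    also have "\<dots> = C * 2 powr a * T powr (- a) * (2 powr a) ^ k"
      using \<open>0 < T\<close> by (simp add: powr_mult powr_divide powr_minus two_power_powr field_simps)
    finally show "prob {\<omega> \<in> space M. T / (2 * 2 ^ k) < X \<omega>}
      \<le> C * 2 powr a * T powr (- a) * (2 powr a) ^ k" .
  next
    have "2 powr (a - q) < 2 powr (0::real)"
      using \<open>a < q\<close> by (subst powr_less_cancel_iff) auto
    then show "2 powr (- q) * 2 powr a < (1::real)"
      by (simp add: powr_add[symmetric])
  qed (use assms in auto)
  also have "T powr q * (C * 2 powr a * T powr (- a)) / (1 - 2 powr (- q) * 2 powr a)
    = C * 2 powr a / (1 - 2 powr (a - q)) * T powr (q - a)"
    using \<open>0 < T\<close> by (simp add: powr_diff powr_minus field_simps)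
  finally show ?thesis .
qed

section \<open>The weak-type bound for sums\<close>

text \<open>Truncation destroys centering, so the off-diagonal products do not vanish: by
  independence they factor into means, which produce the second summand. Boundedness supplies
  integrability of all products.\<close>

lemma expectation_sum_square_le:
  fixes Z :: "'i \<Rightarrow> 'a \<Rightarrow> real" and v m :: real
  assumes "finite I"
    and indep: "indep_vars (\<lambda>_. borel) Z I"
    and bounded: "\<And>i \<omega>. i \<in> I \<Longrightarrow> \<omega> \<in> space M \<Longrightarrow> \<bar>Z i \<omega>\<bar> \<le> B"
    and second: "\<And>i. i \<in> I \<Longrightarrow> expectation (\<lambda>\<omega>. (Z i \<omega>)\<^sup>2) \<le> v"
    and first: "\<And>i. i \<in> I \<Longrightarrow> \<bar>expectation (Z i)\<bar> \<le> m"
    and "0 \<le> v"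
  shows "expectation (\<lambda>\<omega>. (\<Sum>i\<in>I. Z i \<omega>)\<^sup>2) \<le> card I * v + (card I * m)\<^sup>2"
proof -
  have [measurable]: "i \<in> I \<Longrightarrow> Z i \<in> borel_measurable M" for i
    using indep by (auto simp: indep_vars_def)
  have intZ: "integrable M (Z i)" if "i \<in> I" for i
    using that bounded by (intro integrable_const_bound[where B=B]) auto
  have intZZ: "integrable M (\<lambda>\<omega>. Z i \<omega> * Z j \<omega>)" if "i \<in> I" "j \<in> I" for i j
  proof (intro integrable_const_bound[where B="B * B"] AE_I2)
    fix \<omega> assume "\<omega> \<in> space M"
    then show "norm (Z i \<omega> * Z j \<omega>) \<le> B * B"
      using that bounded[of i \<omega>] bounded[of j \<omega>] by (auto simp: abs_mult intro!: mult_mono)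
  qed (use that in measurable)
  \<comment> \<open>The extra m * m on the diagonal is slack that turns the double sum into a
    perfect square.\<close>
  have cross: "expectation (\<lambda>\<omega>. Z i \<omega> * Z j \<omega>) \<le> (if i = j then v else 0) + m * m"
    if ij: "i \<in> I" "j \<in> I" for i j
  proof (cases "i = j")
    case True
    then show ?thesis
      using second[of j] ij by (simp add: power2_eq_square add_increasing2)
  next
    case False
    have "expectation (\<lambda>\<omega>. Z i \<omega> * Z j \<omega>) = expectation (\<lambda>\<omega>. \<Prod>k\<in>{i, j}. Z k \<omega>)"
      using False by simp
    also have "\<dots> = (\<Prod>k\<in>{i, j}. expectation (Z k))"
      using ij intZ by (intro indep_vars_lebesgue_integral indep_vars_subset[OF indep]) auto
    also have "\<dots> \<le> \<bar>expectation (Z i)\<bar> * \<bar>expectation (Z j)\<bar>"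
      using False by (simp add: abs_mult[symmetric])
    also have "\<dots> \<le> m * m"
      using ij by (intro mult_mono first) (use first[of i] in auto)
    finally show ?thesis
      using False by simp
  qed
  have "expectation (\<lambda>\<omega>. (\<Sum>i\<in>I. Z i \<omega>)\<^sup>2) = expectation (\<lambda>\<omega>. \<Sum>i\<in>I. \<Sum>j\<in>I. Z i \<omega> * Z j \<omega>)"
    by (simp add: power2_eq_square sum_product)
  also have "\<dots> = (\<Sum>i\<in>I. \<Sum>j\<in>I. expectation (\<lambda>\<omega>. Z i \<omega> * Z j \<omega>))"
    using intZZ by (simp add: Bochner_Integration.integral_sum Bochner_Integration.integrable_sum)
  also have "\<dots> \<le> (\<Sum>i\<in>I. \<Sum>j\<in>I. (if i = j then v else 0) + m * m)"
    by (intro sum_mono cross)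
  also have "\<dots> = card I * v + (card I * m)\<^sup>2"
    using \<open>finite I\<close> by (simp add: sum.distrib power2_eq_square algebra_simps)
  finally show ?thesis .
qed


text \<open>With L = card I * T^(-a), the three summands of the constant come from the event that
  some variable exceeds T, from the truncated second moments, and from the square of the summed
  truncated means. The last is of order L^2; the assumption L \<le> 1 makes it linear in L.\<close>

lemma prob_abs_sum_gt_le:
  fixes Y :: "'i \<Rightarrow> 'a \<Rightarrow> real"
  assumes "finite I"
    and indep: "indep_vars (\<lambda>_. borel) Y I"
    and tail: "\<And>i t. i \<in> I \<Longrightarrow> 0 < t \<Longrightarrow> prob {\<omega> \<in> space M. t < \<bar>Y i \<omega>\<bar>} \<le> C * t powr (- a)"
    and centered: "\<And>i. i \<in> I \<Longrightarrow> expectation (Y i) = 0"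
    and a: "1 < a" "a < 2" and "0 \<le> C" "0 < T" and small: "card I * T powr (- a) \<le> 1"
  shows "prob {\<omega> \<in> space M. T < \<bar>\<Sum>i\<in>I. Y i \<omega>\<bar>}
    \<le> (C + C * 2 powr a / (1 - 2 powr (a - 2)) + (C * 2 / (1 - 2 powr (1 - a)))\<^sup>2)
      * (card I * T powr (- a))"
proof -
  define b where "b = C * 2 powr a / (1 - 2 powr (a - 2))"
  define m where "m = C * 2 / (1 - 2 powr (1 - a))"
  define L where "L = card I * T powr (- a)"
  \<comment> \<open>Both denominators are positive exactly because a lies strictly between 1 and
    2.\<close>
  have "2 powr (a - 2) < 2 powr (0::real)" "2 powr (1 - a) < 2 powr (0::real)"
    using a by (subst powr_less_cancel_iff; simp)+
  then have "0 \<le> b" "0 \<le> m"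
    using \<open>0 \<le> C\<close> by (auto simp: b_def m_def)
  have "0 \<le> L" "L \<le> 1"
    using small by (auto simp: L_def)
  have [measurable]: "i \<in> I \<Longrightarrow> Y i \<in> borel_measurable M" for i
    using indep by (auto simp: indep_vars_def)
  define Z where "Z i \<omega> = Y i \<omega> * indicator {-T..T} (Y i \<omega>)" for i \<omega>
  define W where "W i \<omega> = Y i \<omega> * indicator {T<..} \<bar>Y i \<omega>\<bar>" for i \<omega>
  have [measurable]: "i \<in> I \<Longrightarrow> Z i \<in> borel_measurable M" "i \<in> I \<Longrightarrow> W i \<in> borel_measurable M" for i
    unfolding Z_def[abs_def] W_def[abs_def] by measurable
  have Z_bounded: "\<bar>Z i \<omega>\<bar> \<le> T" for i \<omega>
    using \<open>0 < T\<close> by (auto simp: Z_def indicator_def)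
  have Y_eq: "Y i \<omega> = Z i \<omega> + W i \<omega>" for i \<omega>
    by (auto simp: Z_def W_def indicator_def)
  have Z_int: "integrable M (Z i)" if "i \<in> I" for i
    using that Z_bounded by (intro integrable_const_bound[where B=T]) auto
  have Z2_int: "integrable M (\<lambda>\<omega>. (Z i \<omega>)\<^sup>2)" if "i \<in> I" for i
    using that Z_bounded \<open>0 < T\<close>
    by (intro integrable_const_bound[where B="T\<^sup>2"]) (auto simp: abs_le_square_iff[symmetric])
  have Z_second: "expectation (\<lambda>\<omega>. (Z i \<omega>)\<^sup>2) \<le> b * T powr (2 - a)" if i: "i \<in> I" for i
  proof -
    have "ennreal (expectation (\<lambda>\<omega>. (Z i \<omega>)\<^sup>2)) = (\<integral>\<^sup>+\<omega>. ennreal ((Z i \<omega>)\<^sup>2) \<partial>M)"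
      using Z2_int[OF i] by (simp add: nn_integral_eq_integral)
    also have "\<dots> = (\<integral>\<^sup>+\<omega>. ennreal (\<bar>Y i \<omega>\<bar> powr 2) * indicator {0..T} \<bar>Y i \<omega>\<bar> \<partial>M)"
      by (intro nn_integral_cong) (auto simp: Z_def indicator_def)
    also have "\<dots> \<le> ennreal (b * T powr (2 - a))"
      unfolding b_def using a i \<open>0 < T\<close> \<open>0 \<le> C\<close> tail[OF i]
      by (intro nn_integral_powr_below_le) auto
    finally show ?thesis
      using \<open>0 \<le> b\<close> by (simp add: ennreal_le_iff)
  qed
  \<comment> \<open>Centering gives E Z = - E W, and W lives above the level T, where the first
    moment is O(T^(1-a)) because a > 1.\<close>
  have Z_first: "\<bar>expectation (Z i)\<bar> \<le> m * T powr (1 - a)" if i: "i \<in> I" for i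
  proof -
    have W_nn: "(\<integral>\<^sup>+\<omega>. ennreal \<bar>W i \<omega>\<bar> \<partial>M) \<le> ennreal (m * T powr (1 - a))"
    proof -
      have "(\<integral>\<^sup>+\<omega>. ennreal \<bar>W i \<omega>\<bar> \<partial>M)
          = (\<integral>\<^sup>+\<omega>. ennreal (\<bar>Y i \<omega>\<bar> powr 1) * indicator {T<..} \<bar>Y i \<omega>\<bar> \<partial>M)"
        by (intro nn_integral_cong) (auto simp: W_def indicator_def)
      also have "\<dots> \<le> ennreal (C * 2 powr 1 / (1 - 2 powr (1 - a)) * T powr (1 - a))"
        using a i \<open>0 < T\<close> \<open>0 \<le> C\<close> tail[OF i] by (intro nn_integral_powr_above_le) auto
      finally show ?thesis
        by (simp add: m_def)
    qed
    \<comment> \<open>With Z and W integrable, so is Y; hence the value 0 in \<open>centered\<close>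
      is a genuine mean, not the default integral of a nonintegrable function.\<close>
    then have W_int: "integrable M (W i)"
      using i by (intro integrableI_bounded) (auto intro: le_less_trans)
    have "0 = expectation (Z i) + expectation (W i)"
      using centered[OF i] Bochner_Integration.integral_add[OF Z_int[OF i] W_int]
      by (simp add: Y_eq[symmetric])
    then have "\<bar>expectation (Z i)\<bar> \<le> expectation (\<lambda>\<omega>. \<bar>W i \<omega>\<bar>)"
      using integral_abs_bound[of M "W i"] by linarith
    moreover have "ennreal (expectation (\<lambda>\<omega>. \<bar>W i \<omega>\<bar>)) \<le> ennreal (m * T powr (1 - a))"
      using W_nn W_int by (subst nn_integral_eq_integral[symmetric]) auto
    ultimately show ?thesis
      using \<open>0 \<le> m\<close> by (simp add: ennreal_le_iff)
  qed
  have Z_indep: "indep_vars (\<lambda>_. borel) Z I"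
    unfolding Z_def[abs_def]
    by (rule indep_vars_compose2[OF indep, where Y="\<lambda>_ x. x * indicator {-T..T} x"]) measurable
  have "expectation (\<lambda>\<omega>. (\<Sum>i\<in>I. Z i \<omega>)\<^sup>2)
      \<le> card I * (b * T powr (2 - a)) + (card I * (m * T powr (1 - a)))\<^sup>2"
    using \<open>finite I\<close> Z_indep Z_second Z_first Z_bounded \<open>0 \<le> b\<close>
    by (intro expectation_sum_square_le) auto
  \<comment> \<open>Here card I * T^(2-a) = L T^2 and card I * T^(1-a) = L T, so both contributions
    scale like T^2.\<close>
  also have "\<dots> = (b * L + m\<^sup>2 * L\<^sup>2) * T\<^sup>2"
    using \<open>0 < T\<close>
    by (simp add: L_def powr_diff powr_minus power2_eq_square field_simps powr_numeral)
  also have "\<dots> \<le> (b * L + m\<^sup>2 * L) * T\<^sup>2"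
    using \<open>0 \<le> L\<close> \<open>L \<le> 1\<close>
    by (intro mult_right_mono add_left_mono mult_left_mono) (auto simp: power2_eq_square mult_left_le)
  finally have second: "expectation (\<lambda>\<omega>. (\<Sum>i\<in>I. Z i \<omega>)\<^sup>2) \<le> (b * L + m\<^sup>2 * L) * T\<^sup>2" .
  have sum_int: "integrable M (\<lambda>\<omega>. (\<Sum>i\<in>I. Z i \<omega>)\<^sup>2)"
  proof (intro integrable_const_bound[where B="(card I * T)\<^sup>2"] AE_I2)
    fix \<omega>
    have "\<bar>\<Sum>i\<in>I. Z i \<omega>\<bar> \<le> (\<Sum>i\<in>I. T)"
      by (intro order_trans[OF sum_abs] sum_mono Z_bounded)
    then show "norm ((\<Sum>i\<in>I. Z i \<omega>)\<^sup>2) \<le> (card I * T)\<^sup>2"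
      using \<open>0 < T\<close> by (auto simp: abs_le_square_iff[symmetric] abs_mult)
  qed measurable
  \<comment> \<open>Chebyshev around 0 rather than around the mean: Markov's inequality for the
    square, whose bound already includes the mean.\<close>
  have "prob {\<omega> \<in> space M. T\<^sup>2 \<le> (\<Sum>i\<in>I. Z i \<omega>)\<^sup>2}
      \<le> expectation (\<lambda>\<omega>. (\<Sum>i\<in>I. Z i \<omega>)\<^sup>2) / T\<^sup>2"
    using \<open>0 < T\<close> sum_int by (intro integral_Markov_inequality_measure[where A="{}"]) auto
  also have "\<dots> \<le> b * L + m\<^sup>2 * L"
    using second \<open>0 < T\<close> by (simp add: divide_le_eq)
  finally have chebyshev: "prob {\<omega> \<in> space M. T\<^sup>2 \<le> (\<Sum>i\<in>I. Z i \<omega>)\<^sup>2} \<le> b * L + m\<^sup>2 * L" .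
  have "prob (\<Union>i\<in>I. {\<omega> \<in> space M. T < \<bar>Y i \<omega>\<bar>})
      \<le> (\<Sum>i\<in>I. prob {\<omega> \<in> space M. T < \<bar>Y i \<omega>\<bar>})"
    using \<open>finite I\<close> by (intro finite_measure_subadditive_finite) auto
  also have "\<dots> \<le> (\<Sum>i\<in>I. C * T powr (- a))"
    using \<open>0 < T\<close> by (intro sum_mono tail)
  also have "\<dots> = C * L"
    by (simp add: L_def)
  finally have large: "prob (\<Union>i\<in>I. {\<omega> \<in> space M. T < \<bar>Y i \<omega>\<bar>}) \<le> C * L" .
  \<comment> \<open>Where no variable exceeds T, truncation changes nothing and the two sums
    agree.\<close>
  have "{\<omega> \<in> space M. T < \<bar>\<Sum>i\<in>I. Y i \<omega>\<bar>}
    \<subseteq> (\<Union>i\<in>I. {\<omega> \<in> space M. T < \<bar>Y i \<omega>\<bar>}) \<union> {\<omega> \<in> space M. T\<^sup>2 \<le> (\<Sum>i\<in>I. Z i \<omega>)\<^sup>2}"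
  proof (intro subsetI)
    fix \<omega> assume \<omega>: "\<omega> \<in> {\<omega> \<in> space M. T < \<bar>\<Sum>i\<in>I. Y i \<omega>\<bar>}"
    show "\<omega> \<in> (\<Union>i\<in>I. {\<omega> \<in> space M. T < \<bar>Y i \<omega>\<bar>}) \<union> {\<omega> \<in> space M. T\<^sup>2 \<le> (\<Sum>i\<in>I. Z i \<omega>)\<^sup>2}"
    proof (cases "\<exists>i\<in>I. T < \<bar>Y i \<omega>\<bar>")
      case False
      then have "(\<Sum>i\<in>I. Z i \<omega>) = (\<Sum>i\<in>I. Y i \<omega>)"
        by (intro sum.cong) (auto simp: Z_def indicator_def)
      then show ?thesis
        using \<omega> \<open>0 < T\<close> by (auto simp: abs_le_square_iff[symmetric])
    qed (use \<omega> in auto)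
  qed
  then have "prob {\<omega> \<in> space M. T < \<bar>\<Sum>i\<in>I. Y i \<omega>\<bar>}
    \<le> prob ((\<Union>i\<in>I. {\<omega> \<in> space M. T < \<bar>Y i \<omega>\<bar>}) \<union> {\<omega> \<in> space M. T\<^sup>2 \<le> (\<Sum>i\<in>I. Z i \<omega>)\<^sup>2})"
    using \<open>finite I\<close> by (intro finite_measure_mono sets.Un sets.finite_UN) measurable
  also have "\<dots> \<le> prob (\<Union>i\<in>I. {\<omega> \<in> space M. T < \<bar>Y i \<omega>\<bar>})
      + prob {\<omega> \<in> space M. T\<^sup>2 \<le> (\<Sum>i\<in>I. Z i \<omega>)\<^sup>2}"
    using \<open>finite I\<close> by (intro measure_Un_le) auto
  also have "\<dots> \<le> (C + b + m\<^sup>2) * L"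
    using large chebyshev by (simp add: algebra_simps)
  finally show ?thesis
    by (simp add: b_def m_def L_def)
qed

section \<open>From the domain of attraction to uniform moments\<close>

text \<open>For t \<ge> 1 the error term is bounded by K, since |x|^(-\<gamma>) \<le> 1 when |x|
  \<ge> 1. The bound is extended to all t > 0 because the truncated second moment uses arbitrarily
  small levels.\<close>

lemma normal_domain_of_attraction_tail:
  assumes "normal_domain_of_attraction a M Y" and "0 < a"
  obtains C where "0 \<le> C"
    and "\<And>t. 0 < t \<Longrightarrow> prob {\<omega> \<in> space M. t < \<bar>Y \<omega>\<bar>} \<le> C * t powr (- a)"
proof -
  from assms(1) obtain A \<epsilon> K \<gamma> where [measurable]: "Y \<in> borel_measurable M"
    and pos: "0 < A" "0 < K" "0 < \<gamma>"
    and \<epsilon>: "\<And>x. 1 \<le> \<bar>x\<bar> \<Longrightarrow> \<bar>\<epsilon> x\<bar> \<le> K * \<bar>x\<bar> powr (- \<gamma>)"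
    and right: "\<And>t. 1 \<le> t \<Longrightarrow> 1 - cdf (distr M borel Y) t = (A + \<epsilon> t) / t powr a"
    and left: "\<And>t. 1 \<le> t \<Longrightarrow> cdf (distr M borel Y) (- t) = (A + \<epsilon> (- t)) / t powr a"
    unfolding normal_domain_of_attraction_def by metis
  have \<epsilon>_le: "\<epsilon> x \<le> K" if "1 \<le> \<bar>x\<bar>" for x
  proof -
    have "\<bar>x\<bar> powr (- \<gamma>) \<le> \<bar>x\<bar> powr 0"
      using that pos by (intro powr_mono) auto
    then have "K * \<bar>x\<bar> powr (- \<gamma>) \<le> K * 1"
      using that pos by (intro mult_left_mono) (auto split: if_splits)
    then show ?thesis
      using \<epsilon>[OF that] by linarith
  qed
  show thesis
  \<comment> \<open>The term 2 * (A + K) pays for the two one-sided tails; the 1 covers t < 1, where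
    t^(-a) \<ge> 1 bounds any probability.\<close>
  proof (rule that[of "1 + 2 * (A + K)"])
    fix t :: real assume "0 < t"
    show "prob {\<omega> \<in> space M. t < \<bar>Y \<omega>\<bar>} \<le> (1 + 2 * (A + K)) * t powr (- a)"
    proof (cases "1 \<le> t")
      case True
      have cdf: "cdf (distr M borel Y) s = prob {\<omega> \<in> space M. Y \<omega> \<le> s}" for s
        by (auto simp: cdf_def measure_distr intro!: arg_cong[where f=prob])
      \<comment> \<open>The left tail Y < -t is enlarged to Y \<le> -t, whose probability is the
        distribution function at -t.\<close>
      have "prob {\<omega> \<in> space M. t < \<bar>Y \<omega>\<bar>}
          \<le> prob ({\<omega> \<in> space M. t < Y \<omega>} \<union> {\<omega> \<in> space M. Y \<omega> \<le> - t})"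
        by (intro finite_measure_mono) auto
      also have "\<dots> \<le> prob {\<omega> \<in> space M. t < Y \<omega>} + prob {\<omega> \<in> space M. Y \<omega> \<le> - t}"
        by (intro measure_Un_le) auto
      also have "prob {\<omega> \<in> space M. t < Y \<omega>} = 1 - cdf (distr M borel Y) t"
        by (subst cdf, subst prob_neg[symmetric]) (auto simp: not_le)
      also have "1 - cdf (distr M borel Y) t + prob {\<omega> \<in> space M. Y \<omega> \<le> - t}
          = (A + \<epsilon> t + (A + \<epsilon> (- t))) * t powr (- a)"
        by (simp only: cdf[symmetric] right[OF True] left[OF True] powr_minus divide_inverse distrib_right)
      also have "\<dots> \<le> (1 + 2 * (A + K)) * t powr (- a)"
        using \<epsilon>_le[of t] \<epsilon>_le[of "- t"] True by (intro mult_right_mono) auto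
      finally show ?thesis .
    next
      case False
      have "1 = t powr 0"
        using \<open>0 < t\<close> by simp
      also have "\<dots> \<le> t powr (- a)"
        using False \<open>0 < t\<close> \<open>0 < a\<close> by (intro powr_mono') auto
      also have "\<dots> \<le> (1 + 2 * (A + K)) * t powr (- a)"
        using pos by (simp add: field_simps)
      finally show ?thesis
        using prob_le_1 order_trans by blast
    qed
  qed (use pos in auto)
qed

end

(* The centering hypothesis makes explicit that the attracting stable law is
   approached without recentering.  It is needed: the tail condition alone is
   invariant under translations of Y, while the conclusion is not. *)
theorem mainTheorem2:
  fixes M :: "'a measure" and Y :: "nat \<Rightarrow> 'a \<Rightarrow> real" and \<alpha> p :: real
  assumes "prob_space M"
    and "1 < \<alpha>" and "\<alpha> < 2"
    and indep: "prob_space.indep_vars M (\<lambda>_. borel) Y {1..}"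
    and ident: "\<And>i. i \<ge> 1 \<Longrightarrow> distr M borel (Y i) = distr M borel (Y 1)"
    and attraction: "\<And>i. i \<ge> 1 \<Longrightarrow> normal_domain_of_attraction \<alpha> M (Y i)"
    and centered: "integral\<^sup>L M (Y 1) = 0"
    and "0 < p" and "p < \<alpha>"
  shows "(SUP n\<in>{1::nat..}. \<integral>\<^sup>+ \<omega>. ennreal (\<bar>(\<Sum>i=1..n. Y i \<omega>) / real n powr (1 / \<alpha>)\<bar> powr p) \<partial>M) < \<infinity>"
proof -
  interpret prob_space M by fact
  have Y_meas [measurable]: "Y i \<in> borel_measurable M" if "1 \<le> i" for i
    using attraction[OF that] by (simp add: normal_domain_of_attraction_def)
  obtain C where "0 \<le> C"
    and C: "\<And>t. 0 < t \<Longrightarrow> prob {\<omega> \<in> space M. t < \<bar>Y 1 \<omega>\<bar>} \<le> C * t powr (- \<alpha>)"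
    using normal_domain_of_attraction_tail[OF attraction[of 1]] \<open>1 < \<alpha>\<close> by auto
  \<comment> \<open>Tail and mean depend only on the law, so both pass from \<open>Y 1\<close> to
    every \<open>Y i\<close>.\<close>
  have tail: "prob {\<omega> \<in> space M. t < \<bar>Y i \<omega>\<bar>} \<le> C * t powr (- \<alpha>)" if "1 \<le> i" "0 < t" for i t
  proof -
    have distr_eq: "measure (distr M borel (Y j)) {x. t < \<bar>x\<bar>} = prob {\<omega> \<in> space M. t < \<bar>Y j \<omega>\<bar>}"
      if "1 \<le> j" for j
      using that by (subst measure_distr) (auto intro!: arg_cong[where f=prob])
    show ?thesis
      using distr_eq[of i] distr_eq[of 1] ident[of i] C[of t] that by simp
  qed
  have mean: "expectation (Y i) = 0" if "1 \<le> i" for i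
  proof -
    have "expectation (Y i) = (\<integral>x. x \<partial>distr M borel (Y i))"
      using that by (subst integral_distr) auto
    also have "\<dots> = (\<integral>x. x \<partial>distr M borel (Y 1))"
      using ident[OF that] by simp
    also have "\<dots> = 0"
      using centered by (subst integral_distr) auto
    finally show ?thesis .
  qed
  define D where "D = C + C * 2 powr \<alpha> / (1 - 2 powr (\<alpha> - 2)) + (C * 2 / (1 - 2 powr (1 - \<alpha>)))\<^sup>2"
  have "2 powr (\<alpha> - 2) < 2 powr (0::real)"
    using \<open>\<alpha> < 2\<close> by (subst powr_less_cancel_iff) auto
  then have "0 \<le> D"
    using \<open>0 \<le> C\<close> by (simp add: D_def)
  \<comment> \<open>The moment bound above level 1 for a variable of weak type \<alpha> with
    constant D; it does not involve n.\<close>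
  define B where "B = ennreal (D * 2 powr p / (1 - 2 powr (p - \<alpha>)) * 1 powr (p - \<alpha>))"
  have bound: "(\<integral>\<^sup>+\<omega>. ennreal (\<bar>(\<Sum>i=1..n. Y i \<omega>) / real n powr (1 / \<alpha>)\<bar> powr p) \<partial>M) \<le> 1 + B"
    if "1 \<le> n" for n
  proof -
    define X where "X \<omega> = \<bar>(\<Sum>i=1..n. Y i \<omega>) / real n powr (1 / \<alpha>)\<bar>" for \<omega>
    have [measurable]: "X \<in> borel_measurable M"
      unfolding X_def[abs_def] by (intro borel_measurable_abs borel_measurable_divide borel_measurable_sum) auto
    have X_tail: "prob {\<omega> \<in> space M. t < X \<omega>} \<le> D * t powr (- \<alpha>)" if "1 \<le> t" for t
    proof -
      \<comment> \<open>This level makes n T^(-\<alpha>) equal to t^(-\<alpha>): the n cancels, and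
        t \<ge> 1 gives the smallness condition of \<open>prob_abs_sum_gt_le\<close>.\<close>
      define T where "T = t * real n powr (1 / \<alpha>)"
      have "0 < T"
        using \<open>1 \<le> t\<close> \<open>1 \<le> n\<close> by (simp add: T_def)
      have scale: "real (card {1..n}) * T powr (- \<alpha>) = t powr (- \<alpha>)"
        using \<open>1 \<le> t\<close> \<open>1 \<le> n\<close> \<open>1 < \<alpha>\<close>
        by (simp add: T_def powr_mult powr_powr powr_minus)
      have "t powr (- \<alpha>) \<le> t powr 0"
        using \<open>1 \<le> t\<close> \<open>1 < \<alpha>\<close> by (intro powr_mono) auto
      then have "t powr (- \<alpha>) \<le> 1"
        using \<open>1 \<le> t\<close> by simp
      have "prob {\<omega> \<in> space M. t < X \<omega>} = prob {\<omega> \<in> space M. T < \<bar>\<Sum>i\<in>{1..n}. Y i \<omega>\<bar>}"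
        using \<open>1 \<le> n\<close> by (simp add: X_def T_def less_divide_eq abs_divide)
      also have "\<dots> \<le> D * (real (card {1..n}) * T powr (- \<alpha>))"
        unfolding D_def
      proof (rule prob_abs_sum_gt_le)
        show "indep_vars (\<lambda>_. borel) Y {1..n}"
          by (rule indep_vars_subset[OF indep]) auto
      qed (use tail mean scale \<open>t powr (- \<alpha>) \<le> 1\<close> \<open>0 < T\<close> \<open>0 \<le> C\<close> \<open>1 < \<alpha>\<close> \<open>\<alpha> < 2\<close> in auto)
      finally show ?thesis
        by (simp only: scale)
    qed
    \<comment> \<open>The tail of X is controlled only from level 1 on; below it X^p \<le> 1, which
      costs at most the total mass 1.\<close>
    have "(\<integral>\<^sup>+\<omega>. ennreal (X \<omega> powr p) \<partial>M)
        \<le> (\<integral>\<^sup>+\<omega>. 1 + ennreal (X \<omega> powr p) * indicator {1<..} (X \<omega>) \<partial>M)"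
    proof (rule nn_integral_mono)
      fix \<omega>
      show "ennreal (X \<omega> powr p) \<le> 1 + ennreal (X \<omega> powr p) * indicator {1<..} (X \<omega>)"
      proof (cases "1 < X \<omega>")
        case False
        then have "X \<omega> powr p \<le> 1"
          using \<open>0 < p\<close> by (intro powr_le1) (auto simp: X_def)
        then show ?thesis
          using False by simp
      qed simp
    qed
    also have "\<dots> = 1 + (\<integral>\<^sup>+\<omega>. ennreal (X \<omega> powr p) * indicator {1<..} (X \<omega>) \<partial>M)"
      by (subst nn_integral_add) (auto simp: emeasure_space_1)
    also have "\<dots> \<le> 1 + B"
      unfolding B_def using X_tail \<open>0 \<le> D\<close> \<open>0 < p\<close> \<open>p < \<alpha>\<close>
      by (intro add_left_mono nn_integral_powr_above_le) auto
    finally show ?thesis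
      by (simp add: X_def)
  qed
  have "(SUP n\<in>{1::nat..}. \<integral>\<^sup>+ \<omega>. ennreal (\<bar>(\<Sum>i=1..n. Y i \<omega>) / real n powr (1 / \<alpha>)\<bar> powr p) \<partial>M) \<le> 1 + B"
    using bound by (intro SUP_least) auto
  also have "\<dots> < \<infinity>"
    by (simp add: B_def)
  finally show ?thesis .
qed

end
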